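(* Let $p\in\beta N$. Then $p$ is prime (that is, $p\neq 1$ and the only ultrafilters $x\in\beta N$ with $x\,\widetilde{\mid}\,p$ are $x=1$ and $x=p$) if and only if $p\in\overline{P}$.
   Context: $N=\{1,2,3,\dots\}$; $\beta N$ is the set of all ultrafilters on $N$; each $n\in N$ is identified with the principal ultrafilter $\{A\subseteq N: n\in A\}$ (so $1\in\beta N$). For $A\subseteq N$, $\overline{A}=\{x\in\beta N: A\in x\}$. $P\subseteq N$ is the set of prime numbers. For $A\subseteq N$ let $A\uparrow=\{n\in N:\exists a\in A,\ a\mid n\}$ and let $\mathcal{U}=\{A\subseteq N: A=A\uparrow\}$. Divisibility of ultrafilters: for $x,y\in\beta N$, $x\,\widetilde{\mid}\,y$ iff $x\cap\mathcal{U}\subseteq y$. *)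

theory Defs
  imports "HOL-Computational_Algebra.Primes"
begin

text \<open>
  An ultrafilter is represented as a set of sets, so that \<open>A \<in> x\<close> and \<open>x \<inter> \<U> \<subseteq> y\<close> can be
  written literally; the library type of filters lives on a whole type, whereas the
  ultrafilters here live on the positive integers.
\<close>

definition ultrafilter_on :: "'a set \<Rightarrow> 'a set set \<Rightarrow> bool" where
  "ultrafilter_on X F \<longleftrightarrow>
     F \<subseteq> Pow X \<and> X \<in> F \<and> {} \<notin> F \<and>
     (\<forall>A\<in>F. \<forall>B\<in>F. A \<inter> B \<in> F) \<and>
     (\<forall>A\<in>F. \<forall>B. A \<subseteq> B \<and> B \<subseteq> X \<longrightarrow> B \<in> F) \<and>
     (\<forall>A. A \<subseteq> X \<longrightarrow> A \<in> F \<or> X - A \<in> F)"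

definition posnat :: "nat set" where
  "posnat = {1..}"

definition betaN :: "nat set set set" where
  "betaN = {x. ultrafilter_on posnat x}"

definition principal_uf :: "nat \<Rightarrow> nat set set" where
  "principal_uf n = {A. A \<subseteq> posnat \<and> n \<in> A}"

definition uf_closure :: "nat set \<Rightarrow> nat set set set" where
  "uf_closure A = {x \<in> betaN. A \<in> x}"

definition primesN :: "nat set" where
  "primesN = {n \<in> posnat. prime n}"

definition div_up :: "nat set \<Rightarrow> nat set" where
  "div_up A = {n \<in> posnat. \<exists>a\<in>A. a dvd n}"

definition div_upsets :: "nat set set" where
  "div_upsets = {A. A \<subseteq> posnat \<and> A = div_up A}"

definition uf_dvd :: "nat set set \<Rightarrow> nat set set \<Rightarrow> bool" where
  "uf_dvd x y \<longleftrightarrow> x \<inter> div_upsets \<subseteq> y"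

definition prime_uf :: "nat set set \<Rightarrow> bool" where
  "prime_uf p \<longleftrightarrow>
     p \<noteq> principal_uf 1 \<and> {x \<in> betaN. uf_dvd x p} = {principal_uf 1, p}"

lemma principal_uf_in_betaN: "n \<in> posnat \<Longrightarrow> principal_uf n \<in> betaN"
  by (auto simp: betaN_def ultrafilter_on_def principal_uf_def)

lemma uf_dvd_principal_iff:
  assumes "m \<in> posnat" "n \<in> posnat"
  shows "uf_dvd (principal_uf m) (principal_uf n) \<longleftrightarrow> m dvd n"
proof
  assume "uf_dvd (principal_uf m) (principal_uf n)"
  moreover have "div_up {m} \<in> principal_uf m \<inter> div_upsets"
    using assms by (auto simp: principal_uf_def div_upsets_def div_up_def intro: dvd_trans)
  ultimately have "div_up {m} \<in> principal_uf n"
    by (auto simp: uf_dvd_def)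
  then show "m dvd n"
    by (auto simp: principal_uf_def div_up_def)
next
  assume "m dvd n"
  then show "uf_dvd (principal_uf m) (principal_uf n)"
    using assms by (auto simp: uf_dvd_def principal_uf_def div_upsets_def div_up_def)
qed

end

theory Submission
  imports Defs
begin

text \<open>
  If \<open>p\<close> contains the primes and \<open>x\<close> divides \<open>p\<close> without being \<open>1\<close>, then any \<open>A \<in> x\<close> may be
  assumed to omit \<open>1\<close>, and a prime in the upward closure of such an \<open>A\<close> lies in \<open>A\<close> itself; hence
  \<open>x \<subseteq> p\<close> and \<open>x = p\<close> by maximality. Conversely, if \<open>f n\<close> is a prime divisor of \<open>n\<close> for every
  \<open>n \<noteq> 1\<close>, then the image of \<open>p \<noteq> 1\<close> under \<open>f\<close> is a divisor of \<open>p\<close> that contains the primes; it is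
  not \<open>1\<close>, so for prime \<open>p\<close> it must be \<open>p\<close>.
\<close>

lemma ultrafilter_on_subset: "A \<subseteq> X" if "ultrafilter_on X F" "A \<in> F"
  using that unfolding ultrafilter_on_def by auto

lemma ultrafilter_on_Int: "A \<inter> B \<in> F" if "ultrafilter_on X F" "A \<in> F" "B \<in> F"
  using that unfolding ultrafilter_on_def by blast

lemma ultrafilter_on_mono: "B \<in> F" if "ultrafilter_on X F" "A \<in> F" "A \<subseteq> B" "B \<subseteq> X"
  using that unfolding ultrafilter_on_def by blast

lemma ultrafilter_on_compl: "X - A \<in> F \<longleftrightarrow> A \<notin> F" if "ultrafilter_on X F" "A \<subseteq> X"
proof
  show "A \<notin> F" if "X - A \<in> F"
  proof
    assume "A \<in> F"
    with that have "(X - A) \<inter> A \<in> F"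
      using \<open>ultrafilter_on X F\<close> by (blast intro: ultrafilter_on_Int)
    moreover have "(X - A) \<inter> A = {}"
      by blast
    ultimately show False
      using \<open>ultrafilter_on X F\<close> by (simp add: ultrafilter_on_def)
  qed
  show "X - A \<in> F" if "A \<notin> F"
    using that \<open>ultrafilter_on X F\<close> \<open>A \<subseteq> X\<close> unfolding ultrafilter_on_def by blast
qed

text \<open>If some \<open>A\<close> in \<open>G\<close> were missing from \<open>F\<close>, then
  \<open>X - A\<close> would lie in \<open>F\<close>, hence in \<open>G\<close>, which cannot
  contain both \<open>A\<close> and its complement.\<close>

lemma ultrafilter_on_maximal:
  assumes F: "ultrafilter_on X F" and G: "ultrafilter_on X G" and "F \<subseteq> G"
  shows "F = G"
proof
  show "G \<subseteq> F"
  proof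
    fix A
    assume "A \<in> G"
    moreover from this have "A \<subseteq> X"
      by (rule ultrafilter_on_subset[OF G])
    ultimately show "A \<in> F"
      using ultrafilter_on_compl[OF F] ultrafilter_on_compl[OF G] \<open>F \<subseteq> G\<close> by blast
  qed
qed fact

text \<open>This is the pushforward of \<open>F\<close> along \<open>f\<close>. Preimages respect
  inclusions, intersections and complements, so each axiom transfers from \<open>F\<close>.\<close>

lemma ultrafilter_on_image:
  assumes F: "ultrafilter_on X F" and f: "f ` X \<subseteq> Y"
  shows "ultrafilter_on Y {A. A \<subseteq> Y \<and> f -` A \<inter> X \<in> F}"
  (is "ultrafilter_on Y ?G")
  unfolding ultrafilter_on_def
proof (intro conjI ballI allI impI)
  show "?G \<subseteq> Pow Y"
    by blast
  have "f -` Y \<inter> X = X"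
    using f by blast
  then show "Y \<in> ?G"
    using F by (simp add: ultrafilter_on_def)
  show "{} \<notin> ?G"
    using F by (simp add: ultrafilter_on_def)
next
  fix A B
  assume "A \<in> ?G" "B \<in> ?G"
  moreover have "f -` (A \<inter> B) \<inter> X = (f -` A \<inter> X) \<inter> (f -` B \<inter> X)"
    by blast
  ultimately show "A \<inter> B \<in> ?G"
    using ultrafilter_on_Int[OF F] by auto
next
  fix A B
  assume "A \<in> ?G" "A \<subseteq> B \<and> B \<subseteq> Y"
  then show "B \<in> ?G"
    using ultrafilter_on_mono[OF F, of "f -` A \<inter> X" "f -` B \<inter> X"] by blast
next
  fix A
  assume "A \<subseteq> Y"
  moreover have "f -` (Y - A) \<inter> X = X - (f -` A \<inter> X)"
    using f by blast
  ultimately show "A \<in> ?G \<or> Y - A \<in> ?G"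
    using ultrafilter_on_compl[OF F, of "f -` A \<inter> X"] by auto
qed

lemma ultrafilter_on_posnat_if_betaN: "x \<in> betaN \<Longrightarrow> ultrafilter_on posnat x"
  by (simp add: betaN_def)

lemma principal_uf_1_in_betaN: "principal_uf 1 \<in> betaN"
  by (rule principal_uf_in_betaN) (simp add: posnat_def)

text \<open>Every member of the principal ultrafilter is a superset of \<open>{n}\<close> and so
  lies in \<open>x\<close>; maximality turns this inclusion into equality.\<close>

lemma eq_principal_uf_if_singleton_mem:
  assumes "x \<in> betaN" "{n} \<in> x"
  shows "x = principal_uf n"
proof -
  note x = ultrafilter_on_posnat_if_betaN[OF assms(1)]
  have "n \<in> posnat"
    using ultrafilter_on_subset[OF x assms(2)] by simp
  moreover have "principal_uf n \<subseteq> x"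
    using ultrafilter_on_mono[OF x assms(2)] by (auto simp: principal_uf_def)
  ultimately show ?thesis
    using ultrafilter_on_maximal[OF ultrafilter_on_posnat_if_betaN x] principal_uf_in_betaN by metis
qed

lemma nonone_mem_if_neq_principal_uf_1:
  assumes "x \<in> betaN" "x \<noteq> principal_uf 1"
  shows "posnat - {1} \<in> x"
proof -
  have "{1} \<subseteq> posnat"
    by (simp add: posnat_def)
  moreover have "{1} \<notin> x"
    using assms eq_principal_uf_if_singleton_mem by metis
  ultimately show ?thesis
    using ultrafilter_on_compl[OF ultrafilter_on_posnat_if_betaN[OF assms(1)]] by simp
qed

lemma uf_dvd_refl: "uf_dvd x x"
  by (simp add: uf_dvd_def)

text \<open>Since 1 divides everything, \<open>posnat\<close> is the only upward closed set
  containing 1, and it lies in every ultrafilter.\<close>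

lemma principal_uf_1_dvd:
  assumes "x \<in> betaN"
  shows "uf_dvd (principal_uf 1) x"
proof -
  have "A = posnat" if "A \<in> principal_uf 1 \<inter> div_upsets" for A
    using that by (auto simp: principal_uf_def div_upsets_def div_up_def)
  then show ?thesis
    using assms by (auto simp: uf_dvd_def betaN_def ultrafilter_on_def)
qed

text \<open>If \<open>f n\<close> lies in an upward closed \<open>A\<close>, so does its multiple
  \<open>n\<close>. Hence the preimage of \<open>A\<close> is a subset of \<open>A\<close>, which
  puts \<open>A\<close> into \<open>x\<close>.\<close>

lemma uf_dvd_image:
  assumes "x \<in> betaN" "\<And>n. n \<in> posnat \<Longrightarrow> f n dvd n"
  shows "uf_dvd {A. A \<subseteq> posnat \<and> f -` A \<inter> posnat \<in> x} x"
  unfolding uf_dvd_def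
proof
  fix A
  assume A: "A \<in> {A. A \<subseteq> posnat \<and> f -` A \<inter> posnat \<in> x} \<inter> div_upsets"
  have "f -` A \<inter> posnat \<subseteq> A"
  proof
    fix n
    assume "n \<in> f -` A \<inter> posnat"
    then have "n \<in> div_up A"
      using assms(2) by (auto simp: div_up_def)
    then show "n \<in> A"
      using A by (auto simp: div_upsets_def)
  qed
  then show "A \<in> x"
    using A assms(1) by (auto intro: ultrafilter_on_mono ultrafilter_on_posnat_if_betaN)
qed

lemma subset_div_up:
  assumes "A \<subseteq> posnat"
  shows "A \<subseteq> div_up A"
proof
  fix n
  assume "n \<in> A"
  with assms show "n \<in> div_up A"
    unfolding div_up_def using dvd_refl[of n] by blast
qed

lemma div_up_in_div_upsets: "div_up A \<in> div_upsets"
proof -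
  have "div_up A \<subseteq> posnat"
    by (auto simp: div_up_def)
  moreover have "div_up (div_up A) \<subseteq> div_up A"
  proof
    fix n
    assume "n \<in> div_up (div_up A)"
    then obtain a m where "n \<in> posnat" "a \<in> A" "a dvd m" "m dvd n"
      by (auto simp: div_up_def)
    then show "n \<in> div_up A"
      using dvd_trans[of a m n] by (auto simp: div_up_def)
  qed
  ultimately show ?thesis
    using subset_div_up[of "div_up A"] by (auto simp: div_upsets_def)
qed

lemma eq_if_uf_dvd_uf_closure_primesN:
  assumes p: "p \<in> uf_closure primesN" and "x \<in> betaN" "uf_dvd x p" "x \<noteq> principal_uf 1"
  shows "x = p"
proof -
  have P: "primesN \<in> p" and ufp: "ultrafilter_on posnat p"
    using p by (auto simp: uf_closure_def betaN_def)
  note ufx = ultrafilter_on_posnat_if_betaN[OF assms(2)]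
  have "A \<in> p" if "A \<in> x" for A
  proof -
    \<comment> \<open>If 1 were kept, \<open>div_up\<close> could be all of \<open>posnat\<close>
      and carry no information about \<open>A\<close>.\<close>
    let ?B = "A \<inter> (posnat - {1})"
    have "A \<subseteq> posnat"
      by (rule ultrafilter_on_subset[OF ufx that])
    have "?B \<in> x"
      using ultrafilter_on_Int[OF ufx that nonone_mem_if_neq_principal_uf_1] assms(2,4) by simp
    then have "div_up ?B \<in> x"
      by (rule ultrafilter_on_mono[OF ufx _ subset_div_up]) (auto simp: div_up_def)
    moreover have "div_up ?B \<in> div_upsets"
      by (rule div_up_in_div_upsets)
    ultimately have "div_up ?B \<in> p"
      using assms(3) unfolding uf_dvd_def by blast
    then have "div_up ?B \<inter> primesN \<in> p"
      by (rule ultrafilter_on_Int[OF ufp _ P])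
    \<comment> \<open>A prime has only the divisors 1 and itself, and 1 is not in \<open>?B\<close>,
      so the prime itself is in \<open>?B\<close>.\<close>
    moreover have "div_up ?B \<inter> primesN \<subseteq> A"
      by (auto simp: div_up_def primesN_def prime_nat_iff)
    ultimately show "A \<in> p"
      using \<open>A \<subseteq> posnat\<close> by (rule ultrafilter_on_mono[OF ufp])
  qed
  then show ?thesis
    by (intro ultrafilter_on_maximal[OF ufx ufp] subsetI)
qed

lemma primesN_mem_if_prime_uf:
  assumes "p \<in> betaN" "prime_uf p"
  shows "primesN \<in> p"
proof -
  obtain g :: "nat \<Rightarrow> nat" where g: "prime (g n)" "g n dvd n" if "n \<noteq> 1" for n
    using prime_factor_nat by metis
  \<comment> \<open>1 has no prime divisor; the value 1 there keeps \<open>f n dvd n\<close> true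
    everywhere.\<close>
  define f where "f n = (if n = 1 then 1 else g n)" for n
  have f_dvd: "f n dvd n" for n
    using g by (simp add: f_def)
  have f: "f ` posnat \<subseteq> posnat"
    using dvd_pos_nat[OF _ f_dvd] by (auto simp: posnat_def Suc_le_eq)
  define x where "x = {A. A \<subseteq> posnat \<and> f -` A \<inter> posnat \<in> p}"
  have "x \<in> betaN"
    using ultrafilter_on_image[OF ultrafilter_on_posnat_if_betaN f] assms(1)
    by (simp add: x_def betaN_def)
  moreover have "uf_dvd x p"
    unfolding x_def using assms(1) f_dvd by (rule uf_dvd_image)
  ultimately have "x = principal_uf 1 \<or> x = p"
    using assms(2) by (auto simp: prime_uf_def)
  moreover have "primesN \<in> x"
  proof -
    have "posnat - {1} \<in> p"
      using assms nonone_mem_if_neq_principal_uf_1 by (simp add: prime_uf_def)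
    \<comment> \<open>The exceptional value at 1 does no harm: \<open>f\<close> takes prime values
      on \<open>posnat - {1}\<close>, which belongs to \<open>p\<close>.\<close>
    moreover have "posnat - {1} \<subseteq> f -` primesN \<inter> posnat"
      using g by (auto simp: f_def primesN_def posnat_def Suc_le_eq prime_gt_0_nat)
    ultimately have "f -` primesN \<inter> posnat \<in> p"
      by (rule ultrafilter_on_mono[OF ultrafilter_on_posnat_if_betaN[OF assms(1)]]) simp
    then show ?thesis
      by (auto simp: x_def primesN_def)
  qed
  \<comment> \<open>As 1 is not prime, this rules out \<open>x = principal_uf 1\<close> and leaves
    \<open>x = p\<close>.\<close>
  moreover have "primesN \<notin> principal_uf 1"
    by (simp add: principal_uf_def primesN_def)
  ultimately show ?thesis
    by blast
qed

theorem theorem2p3: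
  fixes p :: "nat set set"
  assumes "p \<in> betaN"
  shows "prime_uf p \<longleftrightarrow> p \<in> uf_closure primesN"
proof
  assume "prime_uf p"
  with assms show "p \<in> uf_closure primesN"
    by (simp add: uf_closure_def primesN_mem_if_prime_uf)
next
  assume p: "p \<in> uf_closure primesN"
  then have "p \<noteq> principal_uf 1"
    by (auto simp: uf_closure_def principal_uf_def primesN_def)
  moreover have "{x \<in> betaN. uf_dvd x p} = {principal_uf 1, p}"
    using assms principal_uf_1_in_betaN principal_uf_1_dvd uf_dvd_refl
      eq_if_uf_dvd_uf_closure_primesN[OF p] by blast
  ultimately show "prime_uf p"
    by (simp add: prime_uf_def)
qed

end
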